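(* Let $\mathbf d=(2,\dots,2,k)$ be a binary architecture with $L>2$ weight matrices and output dimension $k>1$, and let $\sigma(x)=1/x$. Then $\mathcal V_{\mathbf d,\sigma}(\mathbb C)$ is not filling, i.e. $$\mathcal V_{\mathbf d,\sigma}(\mathbb C)\subsetneq(S^{n(\mathbf d)}(\mathbb C^2))^k\times S^{m(\mathbf d)}(\mathbb C^2).$$
   Context: $S^d(\mathbb C^2)$ is the space of complex binary forms of degree $d$. For a binary architecture $\mathbf d=(2,\dots,2,d_L)$ with complex weights $\mathbf w=(W_1,\dots,W_L)$, $W_1,\dots,W_{L-1}\in\mathbb C^{2\times2}$, $W_L\in\mathbb C^{d_L\times2}$, put $P_{12}=\begin{pmatrix}0&1\\1&0\end{pmatrix}$, $p_i(\mathbf x)=(W_iP_{12}W_{i-1}\cdots P_{12}W_1)\mathbf x$ for $1\le i\le L$ with $j$-th entry $p_{j,i}$, $q_0=q_1=1$, and $q_{i+1}=p_{1,i}p_{2,i}$ for $1\le i\le L-1$. Let $$P_{i,\mathbf w}=p_{i,L}\,q_{L-1}q_{L-3}\cdots q_{\delta(L+1)},\qquad Q_{\mathbf w}=q_Lq_{L-2}\cdots q_{\delta(L)},$$ where $\delta(n)\in\{0,1\}$ is the parity of $n$ ($0$ if even, $1$ if odd). These are the numerators and the common denominator of the network $W_L\circ\sigma\circ\cdots\circ\sigma\circ W_1$ ($\sigma$ entrywise), and are forms of degrees $n(\mathbf d)=L+\delta(L)-1$ and $m(\mathbf d)=L-\delta(L)$. The neuromanifold $\mathcal M_{\mathbf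 d,\sigma}(\mathbb C)$ is the image of $\mathbf w\mapsto(P_{1,\mathbf w},\dots,P_{d_L,\mathbf w},Q_{\mathbf w})\in(S^{n(\mathbf d)}(\mathbb C^2))^{d_L}\times S^{m(\mathbf d)}(\mathbb C^2)$ over all complex weights, and the neurovariety $\mathcal V_{\mathbf d,\sigma}(\mathbb C)$ is its Zariski closure. *)

theory Defs
  imports "HOL-Analysis.Analysis" "HOL-Computational_Algebra.Polynomial"
begin

text \<open>The polynomial ring $C[x_1,x_2]$ is encoded as \<^typ>\<open>complex poly poly\<close>, read as
  $C[x_1][x_2]$: the coefficient of $x_1^a x_2^b$ in \<open>f\<close> is \<open>coeff (coeff f b) a\<close>.\<close>

type_synonym bipoly = "complex poly poly"

definition bicoeff :: "bipoly \<Rightarrow> nat \<Rightarrow> nat \<Rightarrow> complex" where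
  "bicoeff f a b = coeff (coeff f b) a"

definition form_vars :: "bipoly ^ 2" where
  "form_vars = vector [[:[:0, 1:]:], [:0, 1:]]"

text \<open>Binary forms of degree \<open>d\<close>, including the zero polynomial.\<close>

definition binary_forms :: "nat \<Rightarrow> bipoly set" where
  "binary_forms d = {f. \<forall>a b. bicoeff f a b \<noteq> 0 \<longrightarrow> a + b = d}"

definition linear_forms :: "complex ^ 2 ^ 'n \<Rightarrow> bipoly ^ 'n" where
  "linear_forms M = (\<chi> j. \<Sum>l\<in>UNIV. smult [:M $ j $ l:] (form_vars $ l))"

definition P12 :: "complex ^ 2 ^ 2" where
  "P12 = vector [vector [0, 1], vector [1, 0]]"

text \<open>The activation $x \mapsto 1/x$, applied entrywise, sends $(x,y)$ to $P_{12}(x,y)/(xy)$. Moving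
  all denominators to the end writes the network with this activation as the quotient of the
  forms \<open>numerators\<close> and \<open>denominator\<close> below, which are defined for all complex weights.\<close>

text \<open>\<open>inner_matrix W i\<close> is $P_{12} W_i P_{12} W_{i-1} \cdots P_{12} W_1$. The hidden weights
  $W_1,\dots,W_{L-1}$ are given as a sequence of which only the entries at 1, ..., \<open>L - 1\<close>
  are used; the last weight matrix $W_L$, of a different shape, is the separate argument \<open>V\<close>
  below. Its number of rows, the output dimension, is the cardinality of the index type \<open>'k\<close>.\<close>

primrec inner_matrix :: "(nat \<Rightarrow> complex ^ 2 ^ 2) \<Rightarrow> nat \<Rightarrow> complex ^ 2 ^ 2" where
  "inner_matrix W 0 = mat 1"
| "inner_matrix W (Suc i) = P12 ** W (Suc i) ** inner_matrix W i"

definition hidden_p :: "(nat \<Rightarrow> complex ^ 2 ^ 2) \<Rightarrow> nat \<Rightarrow> bipoly ^ 2" where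
  "hidden_p W i = linear_forms (W i ** inner_matrix W (i - 1))"

definition output_p ::
  "nat \<Rightarrow> (nat \<Rightarrow> complex ^ 2 ^ 2) \<Rightarrow> complex ^ 2 ^ 'k \<Rightarrow> bipoly ^ 'k" where
  "output_p L W V = linear_forms (V ** inner_matrix W (L - 1))"

definition q_form :: "(nat \<Rightarrow> complex ^ 2 ^ 2) \<Rightarrow> nat \<Rightarrow> bipoly" where
  "q_form W i = (if i \<le> 1 then 1 else hidden_p W (i - 1) $ 1 * hidden_p W (i - 1) $ 2)"

text \<open>\<open>q_prod W n\<close> is $q_n q_{n-2} \cdots$, ending with $q_0$ or $q_1$ according to the
  parity of \<open>n\<close>.\<close>

definition q_prod :: "(nat \<Rightarrow> complex ^ 2 ^ 2) \<Rightarrow> nat \<Rightarrow> bipoly" where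
  "q_prod W n = (\<Prod>j | j \<le> n \<and> j mod 2 = n mod 2. q_form W j)"

definition numerators ::
  "nat \<Rightarrow> (nat \<Rightarrow> complex ^ 2 ^ 2) \<Rightarrow> complex ^ 2 ^ 'k \<Rightarrow> bipoly ^ 'k" where
  "numerators L W V = (\<chi> i. output_p L W V $ i * q_prod W (L - 1))"

definition denominator :: "nat \<Rightarrow> (nat \<Rightarrow> complex ^ 2 ^ 2) \<Rightarrow> bipoly" where
  "denominator L W = q_prod W L"

definition num_degree :: "nat \<Rightarrow> nat" where
  "num_degree L = L + L mod 2 - 1"

definition den_degree :: "nat \<Rightarrow> nat" where
  "den_degree L = L - L mod 2"

definition ambient_space :: "nat \<Rightarrow> ((bipoly ^ 'k) \<times> bipoly) set" where
  "ambient_space L =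
     {(P, Q). (\<forall>i. P $ i \<in> binary_forms (num_degree L)) \<and> Q \<in> binary_forms (den_degree L)}"

definition neuromanifold :: "nat \<Rightarrow> ((bipoly ^ 'k) \<times> bipoly) set" where
  "neuromanifold L = {(numerators L W V, denominator L W) | W V. True}"

text \<open>Polynomial functions in the coefficients of the forms. On \<open>ambient_space L\<close> the
  coefficients of the monomials of degree \<open>num_degree L\<close>, respectively \<open>den_degree L\<close>, are the
  linear coordinates, and all other coefficients vanish.\<close>

inductive polynomial_fun :: "((bipoly ^ 'k) \<times> bipoly \<Rightarrow> complex) \<Rightarrow> bool" where
  const: "polynomial_fun (\<lambda>_. c)"
| num_coeff: "polynomial_fun (\<lambda>v. bicoeff (fst v $ i) a b)"
| den_coeff: "polynomial_fun (\<lambda>v. bicoeff (snd v) a b)"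
| add: "polynomial_fun f \<Longrightarrow> polynomial_fun g \<Longrightarrow> polynomial_fun (\<lambda>v. f v + g v)"
| mult: "polynomial_fun f \<Longrightarrow> polynomial_fun g \<Longrightarrow> polynomial_fun (\<lambda>v. f v * g v)"

definition zariski_closure ::
  "((bipoly ^ 'k) \<times> bipoly) set \<Rightarrow> ((bipoly ^ 'k) \<times> bipoly) set \<Rightarrow> ((bipoly ^ 'k) \<times> bipoly) set" where
  "zariski_closure X S =
     {v \<in> X. \<forall>f. polynomial_fun f \<longrightarrow> (\<forall>u\<in>S. f u = 0) \<longrightarrow> f v = 0}"

definition neurovariety :: "nat \<Rightarrow> ((bipoly ^ 'k) \<times> bipoly) set" where
  "neurovariety L = zariski_closure (ambient_space L) (neuromanifold L)"

end

theory Submission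
  imports Defs
begin

text \<open>All numerators of the network are multiples of one and the same form
  $H = q_{L-1} q_{L-3} \cdots$ by linear forms. So if $P$ and $R$ are two of them, $P = \ell H$
  and $R = \ell' H$, then $\ell' P - \ell R = 0$ is a syzygy with linear coefficients. For forms of
  degree $n$, such syzygies are the solutions of $n + 2$ linear equations in four unknowns, one for
  each monomial of degree $n + 1$, so a nonzero one forces the $4 \times 4$ minors of this system
  to vanish; if $\ell = \ell' = 0$ they vanish because $P = R = 0$. These minors are
  polynomials in the coefficients of $P$ and $R$.

  One minor suffices, the one of the equations at $y^{n+1}$, $x y^n$, $x^n y$ and $x^{n+1}$.
  Up to sign it is the function \<open>syzygy_minor\<close> below. It vanishes on the neuromanifold
  (lemma \<open>syzygy_minor_neuromanifold\<close>), but at $P = x^n$, $R = y^n$ its value is 1: these two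
  powers are coprime, so the coefficients of a nonzero syzygy have degree at least $n$, which is
  greater than 1. The bound $n \geq 2$ comes from $L > 2$, and the two outputs from $k > 1$.\<close>

lemma linear_forms_nth:
  "linear_forms M $ i = [:[:0, M $ i $ 1:], [:M $ i $ 2:]:]"
  by (simp add: linear_forms_def form_vars_def sum_2 vector_2)

lemma bicoeff_linear_mult:
  "bicoeff (linear_forms M $ i * H) a b =
     (if a = 0 then 0 else M $ i $ 1 * bicoeff H (a - 1) b) +
     (if b = 0 then 0 else M $ i $ 2 * bicoeff H a (b - 1))"
  by (simp add: linear_forms_nth bicoeff_def coeff_pCons split: nat.split)

definition coeff_minor ::
  "'k::finite \<Rightarrow> 'k \<Rightarrow> nat \<times> nat \<Rightarrow> nat \<times> nat \<Rightarrow> (bipoly ^ 'k) \<times> bipoly \<Rightarrow> complex" where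
  "coeff_minor i j s t v =
     bicoeff (fst v $ i) (fst s) (snd s) * bicoeff (fst v $ j) (fst t) (snd t) -
     bicoeff (fst v $ i) (fst t) (snd t) * bicoeff (fst v $ j) (fst s) (snd s)"

text \<open>Let $a_r$ and $b_r$ be the coefficients of $x^r y^{n-r}$ in the two numerators. In the
  unknown syzygy $\lambda P - \mu R = 0$ the equation at $y^{n+1}$ involves only $a_0, b_0$, and the
  equation at $x^{n+1}$ only $a_n, b_n$. Solving these two for $\lambda$ and $\mu$ and substituting
  into the equations at $x y^n$ and $x^n y$ leaves a $2 \times 2$ determinant, and the following
  function is its negative.\<close>

definition syzygy_minor ::
  "nat \<Rightarrow> 'k::finite \<Rightarrow> 'k \<Rightarrow> (bipoly ^ 'k) \<times> bipoly \<Rightarrow> complex" where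
  "syzygy_minor n i j v =
     coeff_minor i j (0, n) (n, 0) v * coeff_minor i j (0, n) (n, 0) v +
     coeff_minor i j (1, n - 1) (0, n) v * coeff_minor i j (n - 1, 1) (n, 0) v"

lemma polynomial_fun_diff:
  assumes "polynomial_fun f" and "polynomial_fun g"
  shows "polynomial_fun (\<lambda>v. f v - g v)"
proof -
  have "polynomial_fun (\<lambda>v. f v + (- 1) * g v)"
    by (intro polynomial_fun.intros assms)
  then show ?thesis by simp
qed

lemma polynomial_fun_syzygy_minor: "polynomial_fun (syzygy_minor n i j)"
proof -
  have "polynomial_fun (coeff_minor i j s t)" for s t
    unfolding coeff_minor_def[abs_def]
    by (intro polynomial_fun_diff polynomial_fun.intros)
  then show ?thesis
    unfolding syzygy_minor_def[abs_def] by (intro polynomial_fun.add polynomial_fun.mult)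
qed

text \<open>With \<open>D\<close> the determinant of the two linear forms, and $h$ and $h'$ the coefficients of
  $y^{n-1}$ and $x^{n-1}$ in \<open>H\<close>, the three coefficient minors in \<open>syzygy_minor\<close> are
  $-D h h'$, $D h^2$ and $-D h'^2$: the inner coefficients of \<open>H\<close> cancel.\<close>

lemma syzygy_minor_common_factor:
  assumes "n \<ge> 2"
    and "fst v $ i = linear_forms M $ i * H" and "fst v $ j = linear_forms M $ j * H"
  shows "syzygy_minor n i j v = 0"
proof -
  define D where "D = M $ i $ 1 * M $ j $ 2 - M $ i $ 2 * M $ j $ 1"
  define h h' where "h = bicoeff H 0 (n - 1)" and "h' = bicoeff H (n - 1) 0"
  note defs = coeff_minor_def assms(2,3) bicoeff_linear_mult D_def h_def h'_def
  have "coeff_minor i j (0, n) (n, 0) v = - D * h * h'"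
    using \<open>n \<ge> 2\<close> by (simp add: defs) (simp add: algebra_simps)
  moreover have "coeff_minor i j (1, n - 1) (0, n) v = D * h * h"
    using \<open>n \<ge> 2\<close> by (simp add: defs) (simp add: algebra_simps)
  moreover have "coeff_minor i j (n - 1, 1) (n, 0) v = - D * h' * h'"
    using \<open>n \<ge> 2\<close> by (simp add: defs) (simp add: algebra_simps)
  ultimately show ?thesis
    by (simp add: syzygy_minor_def)
qed

lemma syzygy_minor_neuromanifold:
  assumes "n \<ge> 2" and "u \<in> neuromanifold L"
  shows "syzygy_minor n i j u = 0"
proof -
  obtain W V where u: "u = (numerators L W V, denominator L W)"
    using assms(2) by (auto simp: neuromanifold_def)
  show ?thesis
    by (rule syzygy_minor_common_factor[OF assms(1),
          where M = "V ** inner_matrix W (L - 1)" and H = "q_prod W (L - 1)"])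
      (simp_all add: u numerators_def output_p_def)
qed

definition power_pair :: "nat \<Rightarrow> 'k::finite \<Rightarrow> 'k \<Rightarrow> (bipoly ^ 'k) \<times> bipoly" where
  "power_pair n i j =
     (\<chi> l. if l = i then [:monom 1 n:] else if l = j then monom 1 n else 0, 0)"

lemma bicoeff_x_power: "bicoeff [:monom 1 n:] a b = (if a = n \<and> b = 0 then 1 else 0)"
  by (simp add: bicoeff_def coeff_pCons split: nat.split)

lemma bicoeff_y_power: "bicoeff (monom 1 n) a b = (if a = 0 \<and> b = n then 1 else 0)"
  by (auto simp: bicoeff_def coeff_monom)

lemma power_pair_in_ambient_space: "power_pair (num_degree L) i j \<in> ambient_space L"
  by (auto simp: power_pair_def ambient_space_def binary_forms_def bicoeff_x_power
      bicoeff_y_power) (simp_all add: bicoeff_def)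

lemma syzygy_minor_power_pair:
  assumes "n \<ge> 2" and "i \<noteq> j"
  shows "syzygy_minor n i j (power_pair n i j) = 1"
  using assms
  by (auto simp: syzygy_minor_def coeff_minor_def power_pair_def bicoeff_x_power bicoeff_y_power)

theorem proposition5p7:
  fixes L :: nat
  assumes "L > 2" and "CARD('k::finite) > 1"
  shows "(neurovariety L :: ((bipoly ^ 'k) \<times> bipoly) set) \<subset> ambient_space L"
proof -
  define n where "n = num_degree L"
  obtain i j :: 'k where "i \<noteq> j"
    using assms(2) by (metis UNIV_I card_le_Suc0_iff_eq finite not_le One_nat_def)
  have n: "n \<ge> 2"
    using assms(1) by (simp add: n_def num_degree_def)
  have "power_pair n i j \<notin> neurovariety L"
  proof
    assume "power_pair n i j \<in> neurovariety L"
    then have "syzygy_minor n i j (power_pair n i j) = 0"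
      using polynomial_fun_syzygy_minor syzygy_minor_neuromanifold[OF n]
      unfolding neurovariety_def zariski_closure_def by blast
    with syzygy_minor_power_pair[OF n \<open>i \<noteq> j\<close>] show False by simp
  qed
  moreover have "power_pair n i j \<in> ambient_space L"
    unfolding n_def by (rule power_pair_in_ambient_space)
  moreover have "(neurovariety L :: ((bipoly ^ 'k) \<times> bipoly) set) \<subseteq> ambient_space L"
    by (auto simp: neurovariety_def zariski_closure_def)
  ultimately show ?thesis by blast
qed

end
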